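(* There is an infinite family $\mathcal{F}$ of connected acyclic digraphs, containing digraphs of arbitrarily large order, such that $\bar{s}_{\mathrm{co}}(D)=O(\sqrt{n})$ and $\bar{s}_{\mathrm{cc}}(D)=O(\sqrt{n})$ for each $D\in\mathcal{F}$, where $n$ is the order of $D$. That is, there is an absolute constant $K>0$ such that for every $D\in\mathcal{F}$ of order $n$, the average size of a convex set of $D$ satisfies $\bar{s}_{\mathrm{co}}(D)\le K\sqrt{n}$ and the average size of a connected convex set of $D$ satisfies $\bar{s}_{\mathrm{cc}}(D)\le K\sqrt{n}$.
   Context: All digraphs are finite; the order of a digraph is its number of vertices. A digraph is acyclic if it has no directed cycle, and connected if its underlying undirected graph is connected. Let $D$ be an acyclic digraph. A non-empty set $X$ of vertices of $D$ is connected if the underlying undirected graph of the induced subdigraph $D[X]$ is connected. A non-empty set $X$ of vertices of $D$ is convex if there is no directed path in $D$ between two vertices of $X$ that contains a vertex not in $X$. A connected convex set is a set that is both connected and convex. Let $\mathcal{CO}(D)$ be the set of all convex sets of $D$ and $\mathcal{CC}(D)$ the set of all connected convex sets of $D$, with $\mathrm{co}(D)=|\mathcal{CO}(D)|$ and $\mathrm{cc}(D)=|\mathcal{CC}(D)|$. The average sizes are $\bar{s}_{\mathrm{co}}(D)=\frac{1}{\mathrm{co}(D)}\sum_{C\in\mathcal{CO}(D)}|C|$ and $\bar{s}_{\mathrm{cc}}(D)=\frac{1}{\mathrm{cc}(D)}\sum_{C\in\mathcal{CC}(D)}|C|$. *)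

theory Defs
  imports Complex_Main "Graph_Theory.Digraph_Component"
begin

text \<open>
  The locale \<open>digraph\<close> of the library describes finite digraphs without loops and parallel arcs;
  \<open>cycle\<close> is a directed cycle and \<open>apath\<close> a directed path (without repeated vertices).
\<close>

locale acyclic_digraph = digraph +
  assumes no_cycle: "\<not> (\<exists>p. cycle p)"

text \<open>
  \<open>Digraph_Component.connected\<close> refers to the underlying undirected graph; the qualifier
  distinguishes it from topological connectedness.
\<close>

definition connected_in :: "('a, 'b) pre_digraph \<Rightarrow> 'a set \<Rightarrow> bool" where
  "connected_in D X \<longleftrightarrow> X \<noteq> {} \<and> X \<subseteq> verts D \<and> Digraph_Component.connected (D \<restriction> X)"

definition convex_in :: "('a, 'b) pre_digraph \<Rightarrow> 'a set \<Rightarrow> bool" where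
  "convex_in D X \<longleftrightarrow> X \<noteq> {} \<and> X \<subseteq> verts D \<and>
     \<not> (\<exists>u\<in>X. \<exists>v\<in>X. \<exists>p. pre_digraph.apath D u p v \<and>
          (\<exists>w\<in>set (pre_digraph.awalk_verts D u p). w \<notin> X))"

definition convex_sets :: "('a, 'b) pre_digraph \<Rightarrow> 'a set set" where
  "convex_sets D = {X. convex_in D X}"

definition connected_convex_sets :: "('a, 'b) pre_digraph \<Rightarrow> 'a set set" where
  "connected_convex_sets D = {X. connected_in D X \<and> convex_in D X}"

lemma (in fin_digraph) finite_convex_sets: "finite (convex_sets G)"
  by (rule finite_subset[of _ "Pow (verts G)"]) (auto simp: convex_sets_def convex_in_def)

lemma (in fin_digraph) finite_connected_convex_sets: "finite (connected_convex_sets G)"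
  by (rule finite_subset[OF _ finite_convex_sets])
    (auto simp: convex_sets_def connected_convex_sets_def)

definition average_size_co :: "('a, 'b) pre_digraph \<Rightarrow> real" where
  "average_size_co D =
     1 / real (card (convex_sets D)) * (\<Sum>C\<in>convex_sets D. real (card C))"

definition average_size_cc :: "('a, 'b) pre_digraph \<Rightarrow> real" where
  "average_size_cc D =
     1 / real (card (connected_convex_sets D)) * (\<Sum>C\<in>connected_convex_sets D. real (card C))"

end

theory Submission
  imports Defs "HOL-Real_Asymp.Real_Asymp"
begin

text \<open>
  Take a chain of \<open>m\<^sup>2\<close> vertices, all below an antichain \<open>B\<close> of \<open>m\<close> vertices, all below an antichain
  \<open>A\<close> of \<open>m\<close> vertices. Each non-empty subset of \<open>A \<union> B\<close> is convex, and it is connected as soon as it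
  meets both antichains; this yields about \<open>4\<^sup>m\<close> sets of size at most \<open>2 m\<close>. A convex set that
  meets the chain cannot contain a vertex of \<open>A\<close> without containing all of \<open>B\<close>, so there are only
  \<open>O(m\<^sup>4 2\<^sup>m)\<close> of these, and they do not affect the order of the average.
\<close>

section \<open>Digraphs given by a level function\<close>

text \<open>Arcs join all pairs of vertices on different levels, upwards, so the arc relation is
  already transitive. Acyclicity, connectivity and convexity thereby become statements about
  inequalities between levels.\<close>

definition level_digraph :: "'a set \<Rightarrow> ('a \<Rightarrow> nat) \<Rightarrow> 'a pair_pre_digraph" where
  "level_digraph V f = \<lparr>pverts = V, parcs = {(u, v). u \<in> V \<and> v \<in> V \<and> f u < f v}\<rparr>"

lemma pverts_level_digraph [simp]: "pverts (level_digraph V f) = V"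
  and parcs_level_digraph:
    "parcs (level_digraph V f) = {(u, v). u \<in> V \<and> v \<in> V \<and> f u < f v}"
  by (simp_all add: level_digraph_def)

lemma pair_wf_level_digraph: "pair_wf_digraph (level_digraph V f)"
  by unfold_locales (auto simp: parcs_level_digraph)

lemma trancl_level_digraph:
  "(u, v) \<in> (parcs (level_digraph V f))\<^sup>+ \<Longrightarrow> f u < f v"
  by (induction rule: trancl_induct) (auto simp: parcs_level_digraph)

lemma reachable_level_digraph:
  assumes "u \<rightarrow>\<^sup>*\<^bsub>with_proj (level_digraph V f)\<^esub> v"
  shows "u = v \<or> f u < f v"
proof -
  have "(u, v) \<in> (parcs (level_digraph V f))\<^sup>*"
    using reachable_rtranclI[OF assms] by simp
  then show ?thesis
    by (rule rtranclE) (auto dest: trancl_level_digraph rtrancl_into_trancl1)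
qed

lemma acyclic_level_digraph:
  assumes "finite V"
  shows "acyclic_digraph (with_proj (level_digraph V f))"
proof -
  have "finite (parcs (level_digraph V f))"
    by (rule finite_subset[of _ "V \<times> V"]) (use assms in \<open>auto simp: parcs_level_digraph\<close>)
  then interpret pair_digraph "level_digraph V f"
    by unfold_locales (use assms in \<open>auto simp: parcs_level_digraph\<close>)
  show ?thesis
  proof unfold_locales
    show "\<not> (\<exists>p. cycle p)"
    proof
      assume "\<exists>p. cycle p"
      then obtain u p where "awalk u p u" "p \<noteq> []"
        by (auto simp: cycle_def)
      then have "(u, u) \<in> (parcs (level_digraph V f))\<^sup>+"
        by (rule reachable1_awalkI)
      then show False
        using trancl_level_digraph[of u u V f] by simp
    qed
  qed
qed

text \<open>Vertices on different levels are adjacent in the underlying graph. Vertices on the same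
  level have a common neighbour, namely whichever of \<open>a\<close> and \<open>b\<close> lies on
  another level.\<close>

lemma connected_level_digraph_restrict:
  assumes "X \<subseteq> V" "a \<in> X" "b \<in> X" "f a \<noteq> f b"
  shows "Digraph_Component.connected (with_proj (level_digraph V f) \<restriction> X)"
proof -
  let ?D = "with_proj (level_digraph V f)"
  interpret D: wf_digraph ?D
    using pair_wf_level_digraph wf_digraph_wp_iff by blast
  interpret R: wf_digraph "?D \<restriction> X"
    by (rule D.wellformed_induce_subgraph)
  interpret M: pair_wf_digraph "mk_symmetric (?D \<restriction> X)" ..
  have adj: "(u, v) \<in> parcs (mk_symmetric (?D \<restriction> X))" if "u \<in> X" "v \<in> X" "f u \<noteq> f v" for u v
    using that(3)
  proof (rule linorder_neqE_nat)
    assume "f u < f v"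
    then show ?thesis
      using that assms(1) unfolding parcs_mk_symmetric
      by (intro UN_I[of "(u, v)"]) (auto simp: parcs_level_digraph)
  next
    assume "f v < f u"
    then show ?thesis
      using that assms(1) unfolding parcs_mk_symmetric
      by (intro UN_I[of "(v, u)"]) (auto simp: parcs_level_digraph)
  qed
  have "u \<rightarrow>\<^sup>*\<^bsub>with_proj (mk_symmetric (?D \<restriction> X))\<^esub> v" if uv: "u \<in> X" "v \<in> X" for u v
  proof -
    obtain w where "w \<in> X" "f w \<noteq> f u"
      using assms by metis
    then show ?thesis
      using uv adj by (metis M.adj_reachable_trans M.reachable_adjI)
  qed
  then show ?thesis
    using assms(2) by (auto simp: Digraph_Component.connected_def strongly_connected_def)
qed

text \<open>A vertex \<open>w\<close> strictly between \<open>u\<close> and \<open>v\<close> in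
  level gives the path \<open>u\<close>, \<open>w\<close>, \<open>v\<close>. Conversely, levels
  increase along a path, so each of its vertices is an end or lies strictly between the ends in
  level.\<close>

lemma convex_in_level_digraph_iff:
  "convex_in (with_proj (level_digraph V f)) X \<longleftrightarrow> X \<noteq> {} \<and> X \<subseteq> V \<and>
     (\<forall>u\<in>X. \<forall>v\<in>X. \<forall>w\<in>V. f u < f w \<longrightarrow> f w < f v \<longrightarrow> w \<in> X)"
  (is "?L \<longleftrightarrow> ?R")
proof -
  interpret pair_wf_digraph "level_digraph V f"
    by (rule pair_wf_level_digraph)
  show ?thesis
  proof
    assume L: ?L
    have "w \<in> X" if "u \<in> X" "v \<in> X" "w \<in> V" "f u < f w" "f w < f v" for u v w
    proof -
      have "X \<subseteq> V"
        using L by (simp add: convex_in_def)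
      then have "apath u [(u, w), (w, v)] v"
        using that by (auto simp: apath_def awalk_simps parcs_level_digraph)
      moreover have "w \<in> set (pawalk_verts u [(u, w), (w, v)])"
        by simp
      ultimately show ?thesis
        using L that(1,2) unfolding convex_in_def awalk_verts_with_proj_eq by blast
    qed
    with L show ?R
      unfolding convex_in_def pverts_level_digraph with_proj_simps(1) by blast
  next
    assume R: ?R
    have "w \<in> X" if uv: "u \<in> X" "v \<in> X" and p: "apath u p v" and w: "w \<in> set (awalk_verts u p)"
      for u v w p
    proof -
      have p': "awalk u p v"
        using p by (simp add: apath_def)
      have uw: "u \<rightarrow>\<^sup>*\<^bsub>with_proj (level_digraph V f)\<^esub> w" and wv: "w \<rightarrow>\<^sup>*\<^bsub>with_proj (level_digraph V f)\<^esub> v"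
        using awalk_verts_reachable_from[OF p' w] awalk_verts_reachable_to[OF p' w] by auto
      have "w \<in> V"
        using reachable_in_vertsE[OF uw] by simp
      moreover have "u = w \<or> f u < f w" "w = v \<or> f w < f v"
        using uw wv by (auto dest: reachable_level_digraph)
      ultimately show ?thesis
        using R uv by blast
    qed
    with R show ?L
      unfolding convex_in_def awalk_verts_with_proj_eq pverts_level_digraph with_proj_simps(1)
      by blast
  qed
qed

section \<open>A chain below two antichains\<close>

text \<open>The vertices below \<open>m\<^sup>2\<close> form the chain, the next \<open>m\<close>
  are the antichain B and the rest are A. The chain has length \<open>m\<^sup>2\<close> so that the
  size \<open>2 * m\<close> of both antichains together is at most twice the square root of the
  order.\<close>

definition tower_level :: "nat \<Rightarrow> nat \<Rightarrow> nat" where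
  "tower_level m v = (if v < m\<^sup>2 then v else if v < m\<^sup>2 + m then m\<^sup>2 else m\<^sup>2 + 1)"

lemma tower_level_chain: "v < m\<^sup>2 \<Longrightarrow> tower_level m v = v"
  and tower_level_B: "m\<^sup>2 \<le> v \<Longrightarrow> v < m\<^sup>2 + m \<Longrightarrow> tower_level m v = m\<^sup>2"
  and tower_level_A: "m\<^sup>2 + m \<le> v \<Longrightarrow> tower_level m v = m\<^sup>2 + 1"
  by (simp_all add: tower_level_def)

definition tower :: "nat \<Rightarrow> nat pair_pre_digraph" where
  "tower m = level_digraph {..<m\<^sup>2 + 2 * m} (tower_level m)"

lemma pverts_tower [simp]: "pverts (tower m) = {..<m\<^sup>2 + 2 * m}"
  by (simp add: tower_def)

lemma convex_in_tower_iff: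
  "convex_in (with_proj (tower m)) X \<longleftrightarrow> X \<noteq> {} \<and> X \<subseteq> {..<m\<^sup>2 + 2 * m} \<and>
     (\<forall>u\<in>X. \<forall>v\<in>X. \<forall>w<m\<^sup>2 + 2 * m. tower_level m u < tower_level m w \<longrightarrow>
        tower_level m w < tower_level m v \<longrightarrow> w \<in> X)"
  unfolding tower_def convex_in_level_digraph_iff by auto

lemma connected_in_tower:
  assumes "X \<subseteq> {..<m\<^sup>2 + 2 * m}" "a \<in> X" "b \<in> X" "tower_level m a \<noteq> tower_level m b"
  shows "connected_in (with_proj (tower m)) X"
  using assms connected_level_digraph_restrict[OF assms]
  by (auto simp: connected_in_def tower_def)

lemma connected_tower:
  assumes "m \<ge> 1"
  shows "Digraph_Component.connected (with_proj (tower m))"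
proof -
  let ?V = "{..<m\<^sup>2 + 2 * m}"
  have "connected_in (with_proj (tower m)) ?V"
    \<comment> \<open>The witnesses are the first vertices of B and A, which exist because
      \<open>m \<ge> 1\<close>.\<close>
    by (rule connected_in_tower[of _ _ "m\<^sup>2" "m\<^sup>2 + m"])
      (use assms in \<open>auto simp: tower_level_def\<close>)
  moreover have "with_proj (tower m) \<restriction> ?V = with_proj (tower m)"
    by (auto simp: induce_subgraph_def with_proj_def tower_def parcs_level_digraph)
  ultimately show ?thesis
    by (simp add: connected_in_def)
qed

lemma connected_convex_tower:
  assumes "P \<subseteq> {m\<^sup>2..<m\<^sup>2 + m}" "P \<noteq> {}" "Q \<subseteq> {m\<^sup>2 + m..<m\<^sup>2 + 2 * m}" "Q \<noteq> {}"
  shows "P \<union> Q \<in> connected_convex_sets (with_proj (tower m))"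
proof -
  obtain p q where pq: "p \<in> P" "q \<in> Q"
    using assms by blast
  have "connected_in (with_proj (tower m)) (P \<union> Q)"
    by (rule connected_in_tower[of _ _ p q]) (use assms pq in \<open>fastforce simp: tower_level_def\<close>)+
  moreover have "convex_in (with_proj (tower m)) (P \<union> Q)"
  proof -
    have "tower_level m u \<ge> m\<^sup>2" if "u \<in> P \<union> Q" for u
      using that assms by (fastforce simp: tower_level_def)
    moreover have "tower_level m u \<le> m\<^sup>2 + 1" for u
      by (simp add: tower_level_def)
    \<comment> \<open>Starting from level \<open>m\<^sup>2\<close> or higher, two strict increases
      would pass the top level \<open>m\<^sup>2 + 1\<close>.\<close>
    ultimately have "\<not> (tower_level m u < tower_level m w \<and> tower_level m w < tower_level m v)"
      if "u \<in> P \<union> Q" for u v w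
      using that by (metis Suc_eq_plus1 less_Suc_eq_le linorder_not_le order_trans)
    moreover have "P \<union> Q \<subseteq> {..<m\<^sup>2 + 2 * m}"
      using assms by fastforce
    ultimately show ?thesis
      unfolding convex_in_tower_iff using assms(2) by blast
  qed
  ultimately show ?thesis
    by (simp add: connected_convex_sets_def)
qed

text \<open>On the chain, levels are the vertices themselves, so convexity makes that part an
  interval. If \<open>X\<close> also contains a vertex of A, then all of B lies strictly between it
  and \<open>c\<close>.\<close>

lemma convex_meeting_chain:
  assumes X: "convex_in (with_proj (tower m)) X" and c: "c \<in> X" "c < m\<^sup>2"
  obtains i j R where "i < m\<^sup>2" "j < m\<^sup>2" "X = {i..j} \<union> R"
    "R \<subseteq> {m\<^sup>2..<m\<^sup>2 + m} \<or>
     (\<exists>Q. R = {m\<^sup>2..<m\<^sup>2 + m} \<union> Q \<and> Q \<subseteq> {m\<^sup>2 + m..<m\<^sup>2 + 2 * m})"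
proof -
  let ?B = "{m\<^sup>2..<m\<^sup>2 + m}" and ?A = "{m\<^sup>2 + m..<m\<^sup>2 + 2 * m}"
  have XV: "X \<subseteq> {..<m\<^sup>2 + 2 * m}"
    using X by (simp add: convex_in_tower_iff)
  have conv: "w \<in> X" if "u \<in> X" "v \<in> X" "w < m\<^sup>2 + 2 * m"
      "tower_level m u < tower_level m w" "tower_level m w < tower_level m v" for u v w
    using X that unfolding convex_in_tower_iff by blast
  define C where "C = X \<inter> {..<m\<^sup>2}"
  define R where "R = X - {..<m\<^sup>2}"
  define i where "i = Min C"
  define j where "j = Max C"
  have C: "finite C" "C \<noteq> {}"
    using c by (auto simp: C_def)
  then have "i \<in> C" "j \<in> C"
    by (simp_all add: i_def j_def)
  then have ij: "i \<in> X" "i < m\<^sup>2" "j \<in> X" "j < m\<^sup>2"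
    by (simp_all add: C_def)
  have "C = {i..j}"
  proof (intro equalityI subsetI)
    fix w assume "w \<in> {i..j}"
    then have "w \<in> X"
      \<comment> \<open>Convexity only yields vertices strictly between \<open>i\<close> and
        \<open>j\<close>; the two ends are in \<open>X\<close> already.\<close>
      using ij conv[of i j w] by (cases "w = i \<or> w = j") (auto simp: tower_level_chain)
    then show "w \<in> C"
      using ij \<open>w \<in> {i..j}\<close> by (simp add: C_def)
  qed (use C in \<open>simp add: i_def j_def\<close>)
  then have "X = {i..j} \<union> R"
    by (auto simp: C_def R_def)
  moreover have "R \<subseteq> ?B \<or> (\<exists>Q. R = ?B \<union> Q \<and> Q \<subseteq> ?A)"
  proof (cases "R \<subseteq> ?B")
    case False
    then obtain a where a: "a \<in> X" "m\<^sup>2 + m \<le> a"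
      by (auto simp: R_def not_less)
    have "w \<in> X" if "w \<in> ?B" for w
      using that a c conv[of c a w] by (simp add: tower_level_chain tower_level_B tower_level_A)
    then have "?B \<subseteq> R"
      by (auto simp: R_def)
    moreover have "R \<subseteq> ?A \<union> ?B"
      using XV by (auto simp: R_def)
    ultimately have "R = ?B \<union> (R \<inter> ?A) \<and> R \<inter> ?A \<subseteq> ?A"
      by blast
    then show ?thesis
      by blast
  qed simp
  ultimately show ?thesis
    using that ij by blast
qed

text \<open>There are \<open>m\<^sup>2\<close> choices for each of \<open>i\<close> and
  \<open>j\<close>, and \<open>2 ^ m\<close> choices for \<open>R\<close> in either case.
  Overcounting is harmless, as only an upper bound is wanted.\<close>

lemma card_convex_meeting_chain:
  "card {X \<in> convex_sets (with_proj (tower m)). X \<inter> {..<m\<^sup>2} \<noteq> {}} \<le> 2 * m ^ 4 * 2 ^ m"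
proof -
  let ?B = "{m\<^sup>2..<m\<^sup>2 + m}" and ?A = "{m\<^sup>2 + m..<m\<^sup>2 + 2 * m}"
  let ?R = "Pow ?B \<union> (\<union>) ?B ` Pow ?A"
  let ?I = "({..<m\<^sup>2} \<times> {..<m\<^sup>2}) \<times> ?R"
  let ?g = "\<lambda>((i, j), R). {i..j} \<union> R :: nat set"
  have "{X \<in> convex_sets (with_proj (tower m)). X \<inter> {..<m\<^sup>2} \<noteq> {}} \<subseteq> ?g ` ?I"
  proof
    fix X assume "X \<in> {X \<in> convex_sets (with_proj (tower m)). X \<inter> {..<m\<^sup>2} \<noteq> {}}"
    then obtain c where "convex_in (with_proj (tower m)) X" "c \<in> X" "c < m\<^sup>2"
      by (auto simp: convex_sets_def)
    then obtain i j R where "i < m\<^sup>2" "j < m\<^sup>2" "X = {i..j} \<union> R"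
      "R \<subseteq> ?B \<or> (\<exists>Q. R = ?B \<union> Q \<and> Q \<subseteq> ?A)"
      by (rule convex_meeting_chain)
    then show "X \<in> ?g ` ?I"
      by (intro image_eqI[of _ _ "((i, j), R)"]) auto
  qed
  then have "card {X \<in> convex_sets (with_proj (tower m)). X \<inter> {..<m\<^sup>2} \<noteq> {}} \<le> card ?I"
    by (rule surj_card_le[rotated]) simp
  also have "card ?R \<le> 2 ^ m + 2 ^ m"
    using card_Un_le[of "Pow ?B" "(\<union>) ?B ` Pow ?A"] card_image_le[of "Pow ?A" "(\<union>) ?B"]
    by (simp add: card_Pow)
  then have "card ?I \<le> m\<^sup>2 * m\<^sup>2 * (2 ^ m + 2 ^ m)"
    by (simp add: card_cartesian_product)
  also have "\<dots> = 2 * m ^ 4 * 2 ^ m"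
    by (simp add: power_numeral_reduce)
  finally show ?thesis .
qed

text \<open>The bound counts pairs of non-empty subsets of B and of A. The set \<open>S\<close> is
  left general to cover both the convex and the connected convex sets.\<close>

lemma card_connected_convex_tower:
  assumes "connected_convex_sets (with_proj (tower m)) \<subseteq> S" "finite S"
  shows "(2 ^ m - 1)\<^sup>2 \<le> card S"
proof -
  let ?B = "{m\<^sup>2..<m\<^sup>2 + m}" and ?A = "{m\<^sup>2 + m..<m\<^sup>2 + 2 * m}"
  let ?I = "(Pow ?B - {{}}) \<times> (Pow ?A - {{}})"
  have "inj_on (\<lambda>(P, Q). P \<union> Q) ?I"
  proof (rule inj_on_inverseI)
    \<comment> \<open>B and A are disjoint, so intersecting with them recovers the pair from its
      union.\<close>
    show "(\<lambda>X. (X \<inter> ?B, X \<inter> ?A)) ((\<lambda>(P, Q). P \<union> Q) z) = z" if "z \<in> ?I" for z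
      using that by fastforce
  qed
  then have "card ?I = card ((\<lambda>(P, Q). P \<union> Q) ` ?I)"
    by (simp add: card_image)
  also have "\<dots> \<le> card S"
    using connected_convex_tower assms by (intro card_mono) auto
  finally show ?thesis
    by (simp add: card_cartesian_product card_Pow power2_eq_square)
qed

section \<open>Averages\<close>

text \<open>Sets that avoid the chain have size at most \<open>2 * m\<close>. Those that meet it are
  few, so bounding their size by the order suffices.\<close>

lemma sum_card_tower_le:
  assumes "S \<subseteq> convex_sets (with_proj (tower m))" "finite S"
  shows "(\<Sum>X\<in>S. real (card X)) \<le> 2 * m * card S + (m\<^sup>2 + 2 * m) * (2 * m ^ 4 * 2 ^ m)"
proof -
  let ?T = "{X \<in> S. X \<inter> {..<m\<^sup>2} \<noteq> {}}"
  let ?U = "{X \<in> convex_sets (with_proj (tower m)). X \<inter> {..<m\<^sup>2} \<noteq> {}}"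
  have V: "X \<subseteq> {..<m\<^sup>2 + 2 * m}" if "X \<in> S" for X
    using that assms by (auto simp: convex_sets_def convex_in_def)
  have "finite ?U"
    by (rule finite_subset[of _ "Pow {..<m\<^sup>2 + 2 * m}"]) (auto simp: convex_sets_def convex_in_def)
  then have "card ?T \<le> card ?U"
    by (rule card_mono) (use assms(1) in blast)
  then have T: "card ?T \<le> 2 * m ^ 4 * 2 ^ m"
    using card_convex_meeting_chain by (rule order_trans)
  have small: "card X \<le> 2 * m" if "X \<in> S - ?T" for X
  proof -
    have "X \<subseteq> {..<m\<^sup>2 + 2 * m} - {..<m\<^sup>2}"
      using that V[of X] by blast
    also have "\<dots> = {m\<^sup>2..<m\<^sup>2 + 2 * m}"
      by auto
    finally show ?thesis
      using card_mono[of "{m\<^sup>2..<m\<^sup>2 + 2 * m}" X] by simp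
  qed
  have large: "card X \<le> m\<^sup>2 + 2 * m" if "X \<in> ?T" for X
    using that V[of X] card_mono[of "{..<m\<^sup>2 + 2 * m}" X] by auto
  have "(\<Sum>X\<in>S. card X) = (\<Sum>X\<in>S - ?T. card X) + (\<Sum>X\<in>?T. card X)"
    using assms(2) by (intro sum.subset_diff) auto
  also have "\<dots> \<le> card (S - ?T) * (2 * m) + card ?T * (m\<^sup>2 + 2 * m)"
    using sum_bounded_above[of "S - ?T" card "2 * m"] sum_bounded_above[of ?T card "m\<^sup>2 + 2 * m"]
      small large by (intro add_mono) auto
  also have "\<dots> \<le> card S * (2 * m) + (2 * m ^ 4 * 2 ^ m) * (m\<^sup>2 + 2 * m)"
    using T assms(2) by (intro add_mono mult_right_mono card_mono) auto
  finally have "(\<Sum>X\<in>S. card X) \<le> 2 * m * card S + (m\<^sup>2 + 2 * m) * (2 * m ^ 4 * 2 ^ m)"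
    by (simp add: mult_ac)
  then show ?thesis
    by (metis of_nat_le_iff of_nat_sum)
qed

text \<open>Since \<open>card S\<close> is at least a quarter of \<open>4 ^ m\<close>, dividing by
  it turns the contribution of the sets that meet the chain into a multiple of
  \<open>m ^ 6 / 2 ^ m\<close>, hence into a constant.\<close>

lemma average_tower_le:
  fixes M :: real
  assumes m: "m \<ge> 1" and M: "real m ^ 6 / 2 ^ m \<le> M"
    and S: "connected_convex_sets (with_proj (tower m)) \<subseteq> S"
      "S \<subseteq> convex_sets (with_proj (tower m))"
  shows "1 / real (card S) * (\<Sum>X\<in>S. real (card X)) \<le> (2 + 24 * M) * sqrt (real (m\<^sup>2 + 2 * m))"
proof -
  have fin: "finite S"
    by (rule finite_subset[of _ "Pow {..<m\<^sup>2 + 2 * m}"])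
      (use S(2) in \<open>auto simp: convex_sets_def convex_in_def\<close>)
  \<comment> \<open>This makes \<open>2 ^ m - 1\<close> at least \<open>2 ^ m / 2\<close>.\<close>
  have "(2::real) ^ m \<ge> 2 ^ 1"
    using m by (intro power_increasing) auto
  then have "(2 ^ m / 2)\<^sup>2 \<le> (2 ^ m - 1 :: real)\<^sup>2"
    by (intro power_mono) auto
  also have "\<dots> = real ((2 ^ m - 1)\<^sup>2)"
    by (simp add: of_nat_diff)
  also have "\<dots> \<le> real (card S)"
    using card_connected_convex_tower[OF S(1) fin] of_nat_le_iff by blast
  finally have cS: "real (card S) \<ge> 2 ^ m * 2 ^ m / 4"
    by (simp add: power2_eq_square)
  then have pos: "real (card S) > 0"
    by (smt (verit) divide_pos_pos mult_pos_pos zero_less_power)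
  have "real m ^ 1 \<le> real m ^ 2"
    using m by (intro power_increasing) auto
  then have "real (m\<^sup>2 + 2 * m) * (2 * real m ^ 4 * 2 ^ m) \<le> 3 * real m ^ 2 * (2 * real m ^ 4 * 2 ^ m)"
    by (intro mult_right_mono) auto
  \<comment> \<open>The factor 24 is 3 from \<open>m\<^sup>2 + 2 * m \<le> 3 * m\<^sup>2\<close>,
    times 2 from the count of sets that meet the chain, times 4 from the lower bound on
    \<open>card S\<close>.\<close>
  also have "\<dots> = 24 * (real m ^ 6 / 2 ^ m) * (2 ^ m * 2 ^ m / 4)"
    by (simp add: field_simps power_numeral_reduce)
  also have "\<dots> \<le> 24 * M * real (card S)"
    using M cS order_trans[OF _ M] by (intro mult_mono) auto
  finally have "(\<Sum>X\<in>S. real (card X)) \<le> (2 * m + 24 * M) * real (card S)"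
    using sum_card_tower_le[OF S(2) fin] by (simp add: algebra_simps)
  then have "1 / real (card S) * (\<Sum>X\<in>S. real (card X)) \<le> 2 * m + 24 * M"
    using pos by (simp add: field_simps)
  \<comment> \<open>As \<open>m \<ge> 1\<close>, the constant term is absorbed into the linear
    one.\<close>
  also have "\<dots> \<le> (2 + 24 * M) * m"
  proof -
    have "0 \<le> M"
      using order_trans[OF _ M] by simp
    then have "M * 1 \<le> M * m"
      using m by (intro mult_left_mono) auto
    then show ?thesis
      by (simp add: algebra_simps)
  qed
  also have "\<dots> \<le> (2 + 24 * M) * sqrt (real (m\<^sup>2 + 2 * m))"
    using order_trans[OF _ M] by (intro mult_left_mono real_le_rsqrt) auto
  finally show ?thesis .
qed

theorem theorem2p1:
  shows "\<exists>F :: nat pair_pre_digraph set.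
    infinite F \<and>
    (\<forall>D\<in>F. acyclic_digraph (with_proj D) \<and> Digraph_Component.connected (with_proj D)) \<and>
    (\<forall>N::nat. \<exists>D\<in>F. card (verts (with_proj D)) \<ge> N) \<and>
    (\<exists>K::real. K > 0 \<and>
      (\<forall>D\<in>F. average_size_co (with_proj D) \<le> K * sqrt (real (card (verts (with_proj D)))) \<and>
             average_size_cc (with_proj D) \<le> K * sqrt (real (card (verts (with_proj D))))))"
proof -
  \<comment> \<open>The index 0 is left out because \<open>tower 0\<close> has no vertices.\<close>
  let ?F = "tower ` {1..}"
  have large: "\<exists>D\<in>?F. card (verts (with_proj D)) \<ge> N" for N
    by (intro bexI[of _ "tower (Suc N)"]) auto
  have "infinite ?F"
  proof
    assume "finite ?F"
    \<comment> \<open>Unbounded orders already force infinitely many members, so injectivity of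
      \<open>tower\<close> need not be shown.\<close>
    then have "finite ((\<lambda>D. card (verts (with_proj D))) ` ?F)"
      by (rule finite_imageI)
    then obtain b where "\<forall>D\<in>?F. card (verts (with_proj D)) \<le> b"
      by (auto simp: finite_nat_set_iff_bounded_le)
    then show False
      using large[of "Suc b"] by (meson Suc_n_not_le_n order_trans)
  qed
  moreover have "acyclic_digraph (with_proj D) \<and> Digraph_Component.connected (with_proj D)"
    if "D \<in> ?F" for D
    using that connected_tower acyclic_level_digraph by (auto simp: tower_def)
  moreover obtain M where M: "M > 0" "real m ^ 6 / 2 ^ m \<le> M" for m
  proof -
    \<comment> \<open>A convergent sequence is bounded, which gives one \<open>M\<close> for all
      \<open>m\<close> and so an absolute constant.\<close>
    have "(\<lambda>m. real m ^ 6 / 2 ^ m) \<longlonglongrightarrow> 0"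
      by real_asymp
    then have "Bseq (\<lambda>m. real m ^ 6 / 2 ^ m)"
      by (intro convergent_imp_Bseq convergentI)
    then show ?thesis
      using that by (auto elim!: BseqE)
  qed
  moreover have "average_size_co (with_proj D) \<le> (2 + 24 * M) * sqrt (real (card (verts (with_proj D)))) \<and>
      average_size_cc (with_proj D) \<le> (2 + 24 * M) * sqrt (real (card (verts (with_proj D))))"
    if D: "D \<in> ?F" for D
  proof -
    obtain m where m: "m \<ge> 1" "D = tower m"
      using D by auto
    have sub: "connected_convex_sets (with_proj D) \<subseteq> convex_sets (with_proj D)"
      by (auto simp: connected_convex_sets_def convex_sets_def)
    show ?thesis
      unfolding average_size_co_def average_size_cc_def
      using average_tower_le[OF m(1) M(2)] sub by (simp add: m)
  qed
  moreover have "2 + 24 * M > 0"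
    using M by simp
  ultimately show ?thesis
    using large by (intro exI[of _ ?F] conjI ballI allI exI[of _ "2 + 24 * M"]) auto
qed

end
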